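(* Let $G^\sigma$ be a connected oriented unicyclic graph of order $n$ whose unique cycle $C_k^\sigma$ has length $k$, and assume $sr(G^\sigma)=k$ if $k$ is even and $sr(G^\sigma)=k+1$ if $k$ is odd. (1) If there exists a vertex $v\in V(C_k^\sigma)$ which is saturated in $G^\sigma\{v\}$, then $G^\sigma\{v\}$ is an oriented star and $\beta(G^\sigma-G^\sigma\{v\})=\frac{k-2}{2}$ if $k$ is even, $=\frac{k-1}{2}$ if $k$ is odd (with no condition on the orientation). (2) If no vertex $v\in V(C_k^\sigma)$ is saturated in $G^\sigma\{v\}$, then: (a) if $k$ is odd, $G\cong U^*$ (with no condition on the orientation); (b) if $k$ is even, $G\cong U^*$ and $C_k^\sigma$ is evenly-oriented.
   Context: An oriented graph $G^\sigma$ is a simple graph $G$ (underlying graph) together with an orientation of each edge. Its skew-adjacency matrix $S(G^\sigma)=(s_{ij})$ has $s_{ij}=1$ if there is an arc from $v_i$ to $v_j$, $s_{ij}=-1$ if there is an arc from $v_j$ to $v_i$, and $0$ otherwise; the skew-rank $sr(G^\sigma)$ is its rank. For an even cycle $u_1\cdots u_ku_1$, its sign is the sign of $\prod_{i=1}^k s_{u_iu_{i+1}}$ ($u_{k+1}=u_1$); it is evenly-oriented if this sign is positive. For a vertex $v$ on the cycle, $G^\sigma\{v\}$ is the component containing $v$ of the graph obtained by deleting the cycle edges (a tree rooted at $v$). A vertex $v$ of a tree $T$ is saturated in $T$ if every maximum matching of $T$ covers $v$. $\beta(H)$ is the matching number. $U^*$ is the graph obtained from a cycle $C_k$ and a star $S_{n-k}$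 (on $n-k$ vertices) by adding an edge between a vertex of $C_k$ and the center of $S_{n-k}$.
   Formalization: The formal theorem adds the assumption k < n (G is not itself a cycle); without it an even cycle that is not evenly-oriented has skew-rank k and no saturated cycle vertex, yet it violates (2)(b), and U* is undefined for n = k. *)

theory Defs
  imports "HOL-Analysis.Analysis"
begin

text \<open>An oriented graph on the (finite) vertex type 'v is given by its ar relation
  ar x y meaning "there is an arc from x to y".  It must be loopless and have no
  pair of opposite arcs (the orientation of a simple graph).\<close>

definition oriented_graph :: "('v \<Rightarrow> 'v \<Rightarrow> bool) \<Rightarrow> bool" where
  "oriented_graph ar \<longleftrightarrow> (\<forall>x. \<not> ar x x) \<and> (\<forall>x y. ar x y \<longrightarrow> \<not> ar y x)"

definition und :: "('v \<Rightarrow> 'v \<Rightarrow> bool) \<Rightarrow> 'v \<Rightarrow> 'v \<Rightarrow> bool" where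
  "und ar x y \<longleftrightarrow> ar x y \<or> ar y x"

definition skew_entry :: "('v \<Rightarrow> 'v \<Rightarrow> bool) \<Rightarrow> 'v \<Rightarrow> 'v \<Rightarrow> real" where
  "skew_entry ar x y = (if ar x y then 1 else if ar y x then -1 else 0)"

definition skew_adj :: "('v::finite \<Rightarrow> 'v \<Rightarrow> bool) \<Rightarrow> real^'v^'v" where
  "skew_adj ar = (\<chi> i j. skew_entry ar i j)"

definition skew_rank :: "('v::finite \<Rightarrow> 'v \<Rightarrow> bool) \<Rightarrow> nat" where
  "skew_rank ar = rank (skew_adj ar)"

definition connected_graph :: "('v \<Rightarrow> 'v \<Rightarrow> bool) \<Rightarrow> bool" where
  "connected_graph E \<longleftrightarrow> (\<forall>x y. E\<^sup>*\<^sup>* x y)"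

definition is_cycle :: "('v \<Rightarrow> 'v \<Rightarrow> bool) \<Rightarrow> 'v list \<Rightarrow> bool" where
  "is_cycle E cs \<longleftrightarrow> length cs \<ge> 3 \<and> distinct cs \<and>
     (\<forall>i < length cs. E (cs ! i) (cs ! ((i + 1) mod length cs)))"

definition cycle_edges :: "'v list \<Rightarrow> 'v set set" where
  "cycle_edges cs = {{cs ! i, cs ! ((i + 1) mod length cs)} | i. i < length cs}"

definition unicyclic :: "('v \<Rightarrow> 'v \<Rightarrow> bool) \<Rightarrow> bool" where
  "unicyclic E \<longleftrightarrow> connected_graph E \<and> (\<exists>cs. is_cycle E cs) \<and>
     (\<forall>cs cs'. is_cycle E cs \<longrightarrow> is_cycle E cs' \<longrightarrow> cycle_edges cs = cycle_edges cs')"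

definition cycle_sign_prod :: "('v \<Rightarrow> 'v \<Rightarrow> bool) \<Rightarrow> 'v list \<Rightarrow> real" where
  "cycle_sign_prod ar cs =
     (\<Prod>i < length cs. skew_entry ar (cs ! i) (cs ! ((i + 1) mod length cs)))"

definition evenly_oriented :: "('v \<Rightarrow> 'v \<Rightarrow> bool) \<Rightarrow> 'v list \<Rightarrow> bool" where
  "evenly_oriented ar cs \<longleftrightarrow> even (length cs) \<and> cycle_sign_prod ar cs > 0"

text \<open>Graph obtained by deleting the cycle edges, and the tree G{v}
  (vertex set and edge relation).\<close>
definition del_cycle :: "('v \<Rightarrow> 'v \<Rightarrow> bool) \<Rightarrow> 'v list \<Rightarrow> 'v \<Rightarrow> 'v \<Rightarrow> bool" where
  "del_cycle E cs x y \<longleftrightarrow> E x y \<and> {x, y} \<notin> cycle_edges cs"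

definition branch_verts :: "('v \<Rightarrow> 'v \<Rightarrow> bool) \<Rightarrow> 'v list \<Rightarrow> 'v \<Rightarrow> 'v set" where
  "branch_verts E cs v = {w. (del_cycle E cs)\<^sup>*\<^sup>* v w}"

definition graph_edges :: "'v set \<Rightarrow> ('v \<Rightarrow> 'v \<Rightarrow> bool) \<Rightarrow> 'v set set" where
  "graph_edges W E = {{x, y} | x y. x \<in> W \<and> y \<in> W \<and> E x y}"

definition is_matching :: "'v set \<Rightarrow> ('v \<Rightarrow> 'v \<Rightarrow> bool) \<Rightarrow> 'v set set \<Rightarrow> bool" where
  "is_matching W E M \<longleftrightarrow> M \<subseteq> graph_edges W E \<and>
     (\<forall>e \<in> M. \<forall>e' \<in> M. e \<noteq> e' \<longrightarrow> e \<inter> e' = {})"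

definition matching_number :: "'v set \<Rightarrow> ('v \<Rightarrow> 'v \<Rightarrow> bool) \<Rightarrow> nat" where
  "matching_number W E = Max (card ` {M. is_matching W E M})"

definition is_max_matching :: "'v set \<Rightarrow> ('v \<Rightarrow> 'v \<Rightarrow> bool) \<Rightarrow> 'v set set \<Rightarrow> bool" where
  "is_max_matching W E M \<longleftrightarrow> is_matching W E M \<and> card M = matching_number W E"

definition saturated :: "'v set \<Rightarrow> ('v \<Rightarrow> 'v \<Rightarrow> bool) \<Rightarrow> 'v \<Rightarrow> bool" where
  "saturated W E v \<longleftrightarrow> (\<forall>M. is_max_matching W E M \<longrightarrow> v \<in> \<Union>M)"

definition is_star :: "'v set \<Rightarrow> ('v \<Rightarrow> 'v \<Rightarrow> bool) \<Rightarrow> bool" where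
  "is_star W E \<longleftrightarrow> (\<exists>c \<in> W. (\<forall>x \<in> W. x \<noteq> c \<longrightarrow> E c x) \<and>
     (\<forall>x \<in> W. \<forall>y \<in> W. E x y \<longrightarrow> x = c \<or> y = c))"

text \<open>The graph U* on vertices {0..<n}: cycle 0,1,...,k-1, the star S_{n-k} on
  {k..<n} with centre k, and the edge joining cycle vertex 0 to the centre k.\<close>
definition ustar_adj :: "nat \<Rightarrow> nat \<Rightarrow> nat \<Rightarrow> nat \<Rightarrow> bool" where
  "ustar_adj k n x y \<longleftrightarrow> x < n \<and> y < n \<and>
     ((x < k \<and> y < k \<and> (y = (x + 1) mod k \<or> x = (y + 1) mod k)) \<or>
      ({x, y} = {0, k}) \<or>
      (x = k \<and> k < y) \<or> (y = k \<and> k < x))"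

definition iso_ustar :: "('v \<Rightarrow> 'v \<Rightarrow> bool) \<Rightarrow> nat \<Rightarrow> nat \<Rightarrow> bool" where
  "iso_ustar E k n \<longleftrightarrow> (\<exists>f. bij_betw f UNIV {0..<n} \<and>
     (\<forall>x y. E x y \<longleftrightarrow> ustar_adj k n (f x) (f y)))"

end

theory Submission
  imports Defs
begin

text \<open>
  Only lower bounds for the skew-rank are needed. Call a vertex set \<open>W\<close> nonsingular if the principal
  submatrix of the skew-adjacency matrix on \<open>W\<close> is; then the skew-rank is at least \<open>card W\<close>. Adding a
  vertex together with a neighbour that is pendant in the enlarged set keeps \<open>W\<close> nonsingular. In a
  unicyclic graph, peeling off pendant vertices therefore shows that the vertices covered by a
  matching \<open>M\<close> form a nonsingular set as soon as some cycle vertex is not matched by a cycle edge; so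
  the skew-rank is at least \<open>2 * card M\<close>.

  The hypothesis on the rank says that it equals \<open>2 * ((k - 1) div 2) + 2\<close>, and the cycle without one
  vertex has a matching with \<open>(k - 1) div 2\<close> edges. If \<open>v\<close> is saturated in its branch, joining maximum
  matchings of the branch and of the rest shows that the branch has matching number 1 (so it is a
  star) and that the rest has matching number \<open>(k - 1) div 2\<close>. If no cycle vertex is saturated, maximum
  matchings of all branches that avoid the cycle, joined with a matching of the cycle without one vertex,
  show that the branches contribute exactly one edge, which leaves only \<open>U*\<close>. Finally, an even cycle
  that is not evenly-oriented is itself nonsingular, and together with that edge it would give rank
  at least \<open>k + 2\<close>.
\<close>

subsection \<open>Nonsingular vertex sets\<close>

text \<open>Nonsingularity is expressed as a trivial kernel, with vectors taken as functions on all
  vertices and sums restricted to \<open>W\<close>. This avoids matrices whose index type depends on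
  \<open>W\<close>.\<close>

definition nonsingular_on :: "('v \<Rightarrow> 'v \<Rightarrow> bool) \<Rightarrow> 'v set \<Rightarrow> bool" where
  "nonsingular_on ar W \<longleftrightarrow>
     (\<forall>x. (\<forall>w\<in>W. (\<Sum>u\<in>W. skew_entry ar w u * x u) = 0) \<longrightarrow> (\<forall>w\<in>W. x w = 0))"

text \<open>Vectors supported on \<open>W\<close> form a space of dimension \<open>card W\<close>.
  Multiplication by the full matrix is injective on it, because the components in \<open>W\<close>
  of the product already determine such a vector.\<close>

lemma card_le_skew_rank:
  fixes ar :: "'v::finite \<Rightarrow> 'v \<Rightarrow> bool"
  assumes "nonsingular_on ar W"
  shows "card W \<le> skew_rank ar"
proof -
  let ?A = "skew_adj ar"
  let ?B = "(\<lambda>w. axis w (1::real)) ` W"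
  let ?V = "{x::real^'v. \<forall>i\<in>Basis. i \<notin> ?B \<longrightarrow> x \<bullet> i = 0}"
  have B: "?B \<subseteq> Basis"
    by (auto simp: axis_in_Basis_iff)
  have V0: "x $ i = 0" if "x \<in> ?V" "i \<notin> W" for x i
  proof -
    have "axis i (1::real) \<in> Basis" "axis i (1::real) \<notin> ?B"
      using that(2) by (auto simp: axis_in_Basis_iff axis_eq_axis)
    then have "x \<bullet> axis i 1 = 0" using that(1) by blast
    then show ?thesis by (simp add: inner_axis)
  qed
  have "card W = card ?B"
    by (rule card_image[symmetric]) (auto simp: inj_on_def axis_eq_axis)
  also have "\<dots> = dim ?V"
    using dim_substandard[OF B] by simp
  also have "\<dots> = dim ((*v) ?A ` ?V)"
  proof (rule dim_image_eq[symmetric])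
    have sub: "subspace ?V" by (rule subspace_substandard)
    show "inj_on ((*v) ?A) (span ?V)"
    proof (rule inj_onI)
      fix x y assume xy: "x \<in> span ?V" "y \<in> span ?V" "?A *v x = ?A *v y"
      define z where "z = x - y"
      have z: "z \<in> ?V"
        unfolding z_def using subspace_diff[OF sub] xy(1,2) span_eq_iff[THEN iffD2, OF sub] by simp
      have Az: "?A *v z = 0" by (simp add: z_def matrix_vector_mult_diff_distrib xy(3))
      have "(\<Sum>u\<in>W. skew_entry ar w u * z $ u) = 0" for w
      proof -
        have "0 = (\<Sum>u\<in>UNIV. skew_entry ar w u * z $ u)"
          using arg_cong[OF Az, of "\<lambda>t. t $ w"]
          by (simp add: matrix_vector_mult_def skew_adj_def)
        also have "\<dots> = (\<Sum>u\<in>W. skew_entry ar w u * z $ u)"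
          by (rule sum.mono_neutral_right) (auto simp: V0[OF z])
        finally show ?thesis by simp
      qed
      then have "\<forall>w\<in>W. z $ w = 0"
        using assms unfolding nonsingular_on_def by blast
      then have "z = 0" using V0[OF z] by (auto simp: vec_eq_iff)
      then show "x = y" by (simp add: z_def)
    qed
  qed auto
  also have "\<dots> \<le> dim (range ((*v) ?A))"
    by (rule dim_subset) auto
  also have "\<dots> = skew_rank ar"
    by (simp add: skew_rank_def rank_dim_range)
  finally show ?thesis .
qed

lemma skew_entry_eq_0_iff: "skew_entry ar x y = 0 \<longleftrightarrow> \<not> und ar x y"
  by (auto simp: skew_entry_def und_def)

lemma und_sym: "und ar x y \<Longrightarrow> und ar y x"
  by (auto simp: und_def)

lemma nonsingular_on_empty: "nonsingular_on ar {}"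
  by (simp add: nonsingular_on_def)

text \<open>Take a kernel vector \<open>x\<close>. Row \<open>l\<close> has its only nonzero entry
  in column \<open>p\<close>, so \<open>x p = 0\<close>; the rows in \<open>W\<close> then reduce to
  the system on \<open>W\<close>, so \<open>x\<close> vanishes there; row \<open>p\<close> finally
  gives \<open>x l = 0\<close>.\<close>

lemma nonsingular_on_pendant:
  fixes ar :: "'v::finite \<Rightarrow> 'v \<Rightarrow> bool"
  assumes W: "nonsingular_on ar W" and irr: "\<And>x. \<not> und ar x x"
    and lp: "l \<notin> W" "p \<notin> W" "und ar l p" and pend: "\<And>w. w \<in> W \<Longrightarrow> \<not> und ar l w"
  shows "nonsingular_on ar (insert l (insert p W))"
  unfolding nonsingular_on_def
proof (intro allI impI)
  fix x assume x: "\<forall>w\<in>insert l (insert p W). (\<Sum>u\<in>insert l (insert p W). skew_entry ar w u * x u) = 0"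
  have lnp: "l \<noteq> p" using irr lp(3) by auto
  have sp: "(\<Sum>u\<in>insert l (insert p W). skew_entry ar w u * x u) =
     skew_entry ar w l * x l + skew_entry ar w p * x p + (\<Sum>u\<in>W. skew_entry ar w u * x u)" for w
    using lp lnp by simp
  have z: "(\<Sum>u\<in>W. skew_entry ar l u * x u) = 0"
    by (rule sum.neutral) (use pend in \<open>auto simp: skew_entry_eq_0_iff\<close>)
  have "skew_entry ar l l = 0" using irr by (simp add: skew_entry_eq_0_iff)
  then have xp: "x p = 0"
    using x[rule_format, of l] sp[of l] z lp(3) skew_entry_eq_0_iff[of ar l p] by simp
  have xW: "\<forall>w\<in>W. x w = 0"
  proof -
    have "(\<Sum>u\<in>W. skew_entry ar w u * x u) = 0" if "w \<in> W" for w
    proof -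
      have "skew_entry ar w l = 0"
        using pend[OF that] und_sym[of ar w l] by (auto simp: skew_entry_eq_0_iff)
      then show ?thesis using x[rule_format, of w] sp[of w] xp that by simp
    qed
    then show ?thesis using W unfolding nonsingular_on_def by blast
  qed
  have "(\<Sum>u\<in>W. skew_entry ar p u * x u) = 0"
    by (rule sum.neutral) (use xW in auto)
  moreover have "skew_entry ar p l \<noteq> 0"
    using und_sym[OF lp(3)] by (simp add: skew_entry_eq_0_iff)
  ultimately have "x l = 0"
    using x[rule_format, of p] sp[of p] xp by simp
  then show "\<forall>w\<in>insert l (insert p W). x w = 0" using xp xW by auto
qed

subsection \<open>Cycles and leaves\<close>

lemma is_cycle_closed_path:
  assumes "distinct ps" "successively E ps" "length ps \<ge> 3" "E (last ps) (hd ps)"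
  shows "is_cycle E ps"
  unfolding is_cycle_def
proof (intro conjI allI impI)
  fix i assume i: "i < length ps"
  have ne: "ps \<noteq> []" using assms(3) by auto
  show "E (ps ! i) (ps ! ((i + 1) mod length ps))"
  proof (cases "Suc i < length ps")
    case True
    then show ?thesis using assms(2) by (simp add: successively_conv_nth)
  next
    case False
    then have "i = length ps - 1" using i by auto
    then show ?thesis using assms(4) ne by (simp add: last_conv_nth hd_conv_nth)
  qed
qed (use assms in auto)

lemma Union_cycle_edges:
  assumes "cs \<noteq> []" shows "\<Union>(cycle_edges cs) = set cs"
proof -
  have "(i + 1) mod length cs < length cs" for i using assms by simp
  then have "\<Union>(cycle_edges cs) \<subseteq> set cs"
    unfolding cycle_edges_def by auto
  moreover have "cs ! i \<in> \<Union>(cycle_edges cs)" if "i < length cs" for i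
    using that unfolding cycle_edges_def by blast
  ultimately show ?thesis by (metis in_set_conv_nth subsetI subset_antisym)
qed

lemma is_cycle_rotate:
  assumes "is_cycle E cs" shows "is_cycle E (rotate m cs)"
  unfolding is_cycle_def
proof (intro conjI allI impI)
  fix i assume i: "i < length (rotate m cs)"
  let ?k = "length cs"
  have k: "?k > 0" using i by auto
  have "(m + i) mod ?k < ?k" using k by simp
  then have "E (cs ! ((m + i) mod ?k)) (cs ! (((m + i) mod ?k + 1) mod ?k))"
    using assms unfolding is_cycle_def by blast
  moreover have "((m + i) mod ?k + 1) mod ?k = (m + (i + 1) mod ?k) mod ?k"
    by (simp add: mod_simps)
  moreover have "(i + 1) mod ?k < ?k" using k by simp
  ultimately show "E (rotate m cs ! i) (rotate m cs ! ((i + 1) mod length (rotate m cs)))"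
    using i by (simp add: nth_rotate)
qed (use assms in \<open>auto simp: is_cycle_def\<close>)

lemma successively_cycle:
  assumes "is_cycle E cs" shows "successively E cs"
  unfolding successively_conv_nth
proof (intro allI impI)
  fix i assume "Suc i < length cs"
  then show "E (cs ! i) (cs ! Suc i)"
    using assms unfolding is_cycle_def by (metis Suc_eq_plus1 Suc_lessD mod_less)
qed

lemma rotate_to_hd:
  assumes "v \<in> set cs" obtains m where "rotate m cs ! 0 = v"
proof -
  obtain i where "i < length cs" "cs ! i = v" using assms by (auto simp: in_set_conv_nth)
  then have "rotate i cs ! 0 = v" by (subst nth_rotate) (auto intro: le_less_trans)
  then show thesis by (rule that)
qed

text \<open>A path that cannot be extended in \<open>W\<close> at its head has all
  \<open>W\<close>-neighbours of the head on it. A neighbour other than the second vertex closes an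
  initial segment to a cycle.\<close>

lemma longest_path_end_on_cycle:
  assumes sym: "\<And>x y. E x y \<Longrightarrow> E y x" and ps: "distinct ps" "successively E ps" "ps \<noteq> []"
    and maxi: "\<And>w. w \<in> W \<Longrightarrow> E w (hd ps) \<Longrightarrow> w \<in> set ps"
    and deg: "a \<in> W" "b \<in> W" "a \<noteq> b" "E (hd ps) a" "E (hd ps) b" and irr: "\<And>x. \<not> E x x"
  obtains i where "i < length ps" "is_cycle E (take (Suc i) ps)"
proof -
  have ex: "\<exists>i. i < length ps \<and> ps ! i = c \<and> i \<noteq> 0" if c: "c \<in> W" "E (hd ps) c" for c
  proof -
    have "c \<in> set ps" using maxi[OF c(1)] sym c(2) by blast
    then obtain i where "i < length ps" "ps ! i = c" by (auto simp: in_set_conv_nth)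
    moreover have "i \<noteq> 0" using irr[of c] c(2) ps(3) calculation(2) by (metis hd_conv_nth)
    ultimately show ?thesis by blast
  qed
  obtain i j where i: "i < length ps" "ps ! i = a" "i \<noteq> 0" and j: "j < length ps" "ps ! j = b" "j \<noteq> 0"
    using ex deg by metis
  \<comment> \<open>Both neighbours have positive positions and differ, so one has position at least
    2; the segment up to it has at least 3 vertices.\<close>
  have "\<exists>i<length ps. i \<ge> 2 \<and> E (hd ps) (ps ! i)"
  proof (cases "i \<ge> 2")
    case True then show ?thesis using i deg by auto
  next
    case False
    then have "j \<ge> 2" using i j deg(3) by (cases "j = 1"; cases "i = 1") auto
    then show ?thesis using j deg by auto
  qed
  then obtain i where i: "i < length ps" "i \<ge> 2" "E (hd ps) (ps ! i)" by blast
  have "is_cycle E (take (Suc i) ps)"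
  proof (rule is_cycle_closed_path)
    show "successively E (take (Suc i) ps)"
      using ps(2) i(1) by (auto simp: successively_conv_nth)
    have "last (take (Suc i) ps) = ps ! i" using i(1) by (simp add: take_Suc_conv_app_nth)
    then show "E (last (take (Suc i) ps)) (hd (take (Suc i) ps))"
      using sym[OF i(3)] by simp
  qed (use ps i in auto)
  then show thesis using that i(1) by blast
qed

text \<open>Without a leaf, every vertex of \<open>W\<close> has two neighbours in \<open>W\<close>,
  so both ends of a longest path in \<open>W\<close> close up to cycles, which have the same vertex
  set \<open>C\<close>. This forces the path to run through exactly \<open>C\<close>. The condition
  on \<open>v\<close> excludes that: an edge from \<open>v\<close> to a vertex of \<open>W\<close>
  off \<open>C\<close> would give a longer path.\<close>

lemma exists_leaf:
  fixes E :: "'v::finite \<Rightarrow> 'v \<Rightarrow> bool"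
  assumes sym: "\<And>x y. E x y \<Longrightarrow> E y x" and irr: "\<And>x. \<not> E x x"
    and uniq: "\<And>ds. is_cycle E ds \<Longrightarrow> set ds = C"
    and W: "W \<noteq> {}" and nbr: "\<And>w. w \<in> W \<Longrightarrow> \<exists>u\<in>W. E w u"
    and v: "v \<in> C" "v \<notin> W \<or> (\<exists>w\<in>W - C. E v w)"
  obtains (leaf) l p where "l \<in> W" "p \<in> W" "E l p" "\<And>q. q \<in> W \<Longrightarrow> E l q \<Longrightarrow> q = p"
proof (rule ccontr)
  assume neg: "\<not> thesis"
  have deg: "\<exists>a b. a \<in> W \<and> b \<in> W \<and> a \<noteq> b \<and> E w a \<and> E w b" if w: "w \<in> W" for w
  proof -
    obtain a where a: "a \<in> W" "E w a" using nbr[OF w] by blast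
    then show ?thesis using neg leaf[OF w a] by blast
  qed
  let ?P = "\<lambda>ps. distinct ps \<and> successively E ps \<and> set ps \<subseteq> W"
  obtain w0 where "w0 \<in> W" using W by blast
  then have P0: "?P [w0]" by simp
  have bd: "\<forall>ps. ?P ps \<longrightarrow> length ps < Suc (card W)"
    by (metis card_mono distinct_card finite less_Suc_eq_le)
  obtain ps where ps: "?P ps" "\<And>qs. ?P qs \<Longrightarrow> length qs \<le> length ps"
    using ex_has_greatest_nat[of ?P "[w0]" length, OF P0 bd] by blast
  have ne: "ps \<noteq> []" using ps(2)[OF P0] by auto
  have hdc: "\<exists>i<length qs. is_cycle E (take (Suc i) qs)"
    if qs: "?P qs" "length qs = length ps" for qs
  proof -
    have qne: "qs \<noteq> []" using qs ne by auto
    obtain a b where ab: "a \<in> W" "b \<in> W" "a \<noteq> b" "E (hd qs) a" "E (hd qs) b"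
      using deg[of "hd qs"] qs qne by (metis hd_in_set subsetD)
    have "w \<in> set qs" if "w \<in> W" "E w (hd qs)" for w
    proof (rule ccontr)
      assume "w \<notin> set qs"
      then have "?P (w # qs)" using that qs qne by (simp add: successively_Cons)
      then show False using ps(2) qs(2) by fastforce
    qed
    from longest_path_end_on_cycle[OF sym _ _ qne this ab irr] qs
    show ?thesis by metis
  qed
  obtain i where i: "i < length ps" "is_cycle E (take (Suc i) ps)"
    using hdc[of ps] ps(1) by blast
  have "successively E (rev ps)"
    using ps(1) sym by (auto simp: successively_conv_sorted_wrt successively_rev intro: successively_mono)
  then obtain j where j: "j < length ps" "is_cycle E (take (Suc j) (rev ps))"
    using hdc[of "rev ps"] ps(1) by auto
  have Ci: "set (take (Suc i) ps) = C" using uniq i by blast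
  \<comment> \<open>The last vertex begins the reversed path, so it lies on the cycle closed at that
    end, hence also on the one closed at the other end. The initial segment therefore reaches the
    end of the path.\<close>
  have "last ps \<in> set (take (Suc j) (rev ps))"
    using ne by (metis hd_in_set hd_rev hd_take take_eq_Nil zero_less_Suc less_numeral_extra(3) rev_is_Nil_conv)
  then have "last ps \<in> set (take (Suc i) ps)" using uniq j Ci by blast
  then obtain m where "m < Suc i" "m < length ps" "ps ! m = ps ! (length ps - 1)"
    using ne by (auto simp: in_set_conv_nth last_conv_nth)
  then have "m = length ps - 1" using ps(1) ne by (auto simp: nth_eq_iff_index_eq)
  then have "take (Suc i) ps = ps" using \<open>m < Suc i\<close> by simp
  then have pc: "is_cycle E ps" "set ps = C" using i Ci by auto
  then have "v \<in> W" using v ps by blast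
  then obtain w where w: "w \<in> W" "w \<notin> C" "E v w" using v by blast
  \<comment> \<open>The whole path is a cycle, so it can be cut open at \<open>v\<close> and
    prolonged by \<open>w\<close>.\<close>
  obtain m where m: "rotate m ps ! 0 = v" using rotate_to_hd v(1) pc(2) by metis
  have "hd (rotate m ps) = v" using m ne by (simp add: hd_conv_nth)
  then have "?P (w # rotate m ps)"
    using w ps(1) pc ne sym[OF w(3)] successively_cycle[OF is_cycle_rotate[OF pc(1)], of m]
    by (simp add: successively_Cons)
  then show False using ps(2) by fastforce
qed

subsection \<open>Matchings\<close>

lemma is_matchingD:
  assumes "is_matching W E M" "e \<in> M"
  obtains x y where "e = {x, y}" "x \<in> W" "y \<in> W" "E x y"
  using assms unfolding is_matching_def graph_edges_def by blast

lemma is_matching_subset: "is_matching W E M \<Longrightarrow> N \<subseteq> M \<Longrightarrow> is_matching W E N"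
  unfolding is_matching_def by (meson subset_iff)

lemma is_matching_mono:
  assumes "is_matching W E M" "W \<subseteq> W'" "\<And>x y. E x y \<Longrightarrow> E' x y"
  shows "is_matching W' E' M"
proof -
  have "graph_edges W E \<subseteq> graph_edges W' E'"
    using assms(2,3) unfolding graph_edges_def by blast
  then show ?thesis using assms(1) unfolding is_matching_def by (meson order_trans)
qed

lemma Union_matching_subset: "is_matching W E M \<Longrightarrow> \<Union>M \<subseteq> W"
  by (auto elim: is_matchingD)

lemma is_matching_Un:
  assumes "is_matching W E M" "is_matching W E N" "\<Union>M \<inter> \<Union>N = {}"
  shows "is_matching W E (M \<union> N)"
proof -
  have "e \<inter> f = {}" "f \<inter> e = {}" if "e \<in> M" "f \<in> N" for e f
    using assms(3) that by blast+
  then show ?thesis using assms(1,2) unfolding is_matching_def by (metis Un_iff Un_least)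
qed

lemma card_matching_Un:
  fixes M N :: "'v::finite set set"
  assumes "is_matching W E M" "\<Union>M \<inter> \<Union>N = {}"
  shows "card (M \<union> N) = card M + card N"
proof -
  \<comment> \<open>Disjointness of the covered vertex sets separates the edges only because no edge
    is empty.\<close>
  have "e \<noteq> {}" if "e \<in> M" for e using is_matchingD[OF assms(1) that] by blast
  then have "M \<inter> N = {}" using assms(2) by blast
  then show ?thesis by (simp add: card_Un_disjoint)
qed

lemma card_Union_matching:
  fixes M :: "'v::finite set set"
  assumes "is_matching W E M" "\<And>x. \<not> E x x"
  shows "card (\<Union>M) = 2 * card M"
proof -
  have "card (\<Union>M) = sum card M"
  proof (rule card_Union_disjoint)
    show "pairwise disjnt M" using assms(1)
      by (auto simp: is_matching_def pairwise_def disjnt_def)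
  qed auto
  also have "\<dots> = (\<Sum>e\<in>M. 2)"
  proof (rule sum.cong)
    fix e assume "e \<in> M"
    then obtain x y where "e = {x, y}" "E x y" using is_matchingD[OF assms(1)] by metis
    moreover from this have "x \<noteq> y" using assms(2) by blast
    ultimately show "card e = 2" by simp
  qed simp
  finally show ?thesis by simp
qed

lemma card_le_matching_number:
  fixes M :: "'v::finite set set"
  assumes "is_matching W E M" shows "card M \<le> matching_number W E"
  unfolding matching_number_def by (rule Max_ge) (use assms in auto)

lemma max_matching_exists:
  fixes E :: "'v::finite \<Rightarrow> 'v \<Rightarrow> bool"
  obtains M where "is_max_matching W E M"
proof -
  have "is_matching W E {}" by (simp add: is_matching_def)
  then have "Max (card ` {M. is_matching W E M}) \<in> card ` {M. is_matching W E M}"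
    by (intro Max_in) auto
  then show thesis using that unfolding is_max_matching_def matching_number_def by auto
qed

text \<open>Induction by removing a matching edge. The subgraph induced on the covered vertices has
  a leaf, since \<open>v\<close> is either uncovered or matched to a vertex off the cycle; the
  leaf's only neighbour there must be its partner in \<open>M\<close>. The condition
  \<open>off\<close> passes to smaller matchings.\<close>

lemma nonsingular_on_matching:
  fixes ar :: "'v::finite \<Rightarrow> 'v \<Rightarrow> bool"
  assumes irr: "\<And>x. \<not> und ar x x"
    and uniq: "\<And>ds. is_cycle (und ar) ds \<Longrightarrow> set ds = C"
    and v: "v \<in> C" and M: "is_matching UNIV (und ar) M"
    and off: "\<And>e. e \<in> M \<Longrightarrow> v \<in> e \<Longrightarrow> \<not> e \<subseteq> C"
  shows "nonsingular_on ar (\<Union>M)"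
  using M off
proof (induction "card M" arbitrary: M)
  case 0
  then show ?case by (simp add: nonsingular_on_empty)
next
  case (Suc m)
  let ?W = "\<Union>M"
  have part: "\<exists>p\<in>?W. und ar w p \<and> {w, p} \<in> M" if "w \<in> ?W" for w
  proof -
    obtain e where e: "e \<in> M" "w \<in> e" using \<open>w \<in> ?W\<close> by blast
    then obtain x y where xy: "e = {x, y}" "und ar x y" using is_matchingD[OF Suc.prems(1)] by metis
    show ?thesis
    proof (cases "w = x")
      case True then show ?thesis using e xy by blast
    next
      case False
      then have "w = y" using e xy by blast
      then show ?thesis using e xy und_sym[OF xy(2)] by (metis UnionI insertI1 insert_commute)
    qed
  qed
  have "?W \<noteq> {}"
  proof -
    obtain e where "e \<in> M" using Suc.hyps(2) by (metis Zero_not_Suc card.empty ex_in_conv)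
    then show ?thesis using is_matchingD[OF Suc.prems(1)] by blast
  qed
  moreover have "v \<notin> ?W \<or> (\<exists>w\<in>?W - C. und ar v w)"
  proof (cases "v \<in> ?W")
    case True
    then obtain p where "p \<in> ?W" "und ar v p" "{v, p} \<in> M" using part by blast
    then show ?thesis using Suc.prems(2)[of "{v, p}"] v by blast
  qed blast
  ultimately obtain l p where lp: "l \<in> ?W" "p \<in> ?W" "und ar l p"
    and leaf: "\<And>q. q \<in> ?W \<Longrightarrow> und ar l q \<Longrightarrow> q = p"
    using exists_leaf[of "und ar" C ?W v] und_sym irr uniq v part by (metis (no_types, lifting))
  have lpM: "{l, p} \<in> M" using part[OF lp(1)] leaf by blast
  define N where "N = M - {{l, p}}"
  have NM: "N \<subseteq> M" by (auto simp: N_def)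
  have "e \<inter> {l, p} = {}" if "e \<in> N" for e
    using that lpM Suc.prems(1) unfolding N_def is_matching_def by simp
  then have lpN: "l \<notin> \<Union>N" "p \<notin> \<Union>N" by auto
  have W: "?W = insert l (insert p (\<Union>N))" using lpM by (auto simp: N_def)
  have "nonsingular_on ar (\<Union>N)"
  proof (rule Suc.hyps(1))
    show "m = card N" using Suc.hyps(2) lpM by (simp add: N_def)
    show "is_matching UNIV (und ar) N" using is_matching_subset[OF Suc.prems(1) NM] .
    show "\<not> e \<subseteq> C" if "e \<in> N" "v \<in> e" for e using Suc.prems(2) that NM by blast
  qed
  then have "nonsingular_on ar (insert l (insert p (\<Union>N)))"
  proof (rule nonsingular_on_pendant[OF _ irr lpN lp(3)])
    fix w assume "w \<in> \<Union>N"
    then show "\<not> und ar l w" using leaf[of w] lpN NM by blast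
  qed
  then show ?case by (simp only: W)
qed

section \<open>The kernel of an even cycle that is not evenly-oriented\<close>

text \<open>The kernel equation at a cycle vertex ties the values at its two neighbours together by
  a sign. As the length is even, steps of length two lead once round the cycle, and the accumulated
  sign is the product over all cycle edges, which is -1. So every value equals its negative.\<close>

lemma nonsingular_on_oddly_oriented_cycle:
  fixes ar :: "'v::finite \<Rightarrow> 'v \<Rightarrow> bool"
  assumes orient: "oriented_graph ar" and cyc: "is_cycle (und ar) cs"
    and chordless: "\<And>x y. x \<in> set cs \<Longrightarrow> y \<in> set cs \<Longrightarrow> und ar x y \<Longrightarrow> {x, y} \<in> cycle_edges cs"
    and ev: "even (length cs)" and neg: "\<not> cycle_sign_prod ar cs > 0"
  shows "nonsingular_on ar (set cs)"
  unfolding nonsingular_on_def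
proof (intro allI impI)
  fix x assume x: "\<forall>w\<in>set cs. (\<Sum>u\<in>set cs. skew_entry ar w u * x u) = 0"
  define k where "k = length cs"
  have k: "k \<ge> 3" and dist: "distinct cs" using cyc by (auto simp: is_cycle_def k_def)
  \<comment> \<open>Indices are read modulo \<open>k\<close>, so that walking round the cycle is
    mere addition.\<close>
  define c where "c i = cs ! (i mod k)" for i
  define s where "s i = skew_entry ar (c i) (c (Suc i))" for i
  define y where "y i = x (c i)" for i
  have modk: "i mod k < length cs" for i
    unfolding k_def[symmetric] using k by simp
  have cin: "c i \<in> set cs" for i using modk by (simp add: c_def)
  have ceq: "c i = c j \<longleftrightarrow> i mod k = j mod k" for i j
    unfolding c_def by (rule nth_eq_iff_index_eq[OF dist modk modk])
  have adj: "und ar (c i) (c (Suc i))" for i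
  proof -
    have "und ar (cs ! (i mod k)) (cs ! ((i mod k + 1) mod k))"
      using cyc modk[of i] unfolding is_cycle_def k_def by blast
    then show ?thesis by (simp add: c_def mod_simps)
  qed
  have ss: "s i * s i = 1" for i
    using adj[of i] by (auto simp: s_def skew_entry_def und_def)
  have step: "y (i + 2) = s i * s (Suc i) * y i" for i
  proof -
    have ne: "c i \<noteq> c (i + 2)"
    proof
      assume "c i = c (i + 2)"
      then have "(i + 2) mod k = i mod k" by (simp add: ceq)
      then have "k dvd (i + 2) - i" by (metis mod_eq_dvd_iff_nat le_add1)
      then show False using k by (auto dest: dvd_imp_le)
    qed
    \<comment> \<open>Since the cycle has no chords, only the two cycle neighbours contribute to the
      row of \<open>c (Suc i)\<close>.\<close>
    have nz: "u = c i \<or> u = c (i + 2)" if u: "u \<in> set cs" "und ar (c (Suc i)) u" for u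
    proof -
      have "{c (Suc i), u} \<in> cycle_edges cs" using chordless cin u by blast
      then obtain j where j: "j < k" "{c (Suc i), u} = {c j, c (Suc j)}"
        unfolding cycle_edges_def by (auto simp: c_def k_def)
      then consider "c (Suc i) = c j" "u = c (Suc j)" | "c (Suc i) = c (Suc j)" "u = c j"
        by (auto simp: doubleton_eq_iff)
      then show ?thesis
      proof cases
        case 1
        then have "Suc (Suc i) mod k = Suc j mod k" unfolding ceq by (metis mod_Suc_eq)
        then show ?thesis using 1 ceq by simp
      next
        case 2
        then have "Suc i mod k = Suc j mod k" by (simp add: ceq)
        then have "i mod k = j mod k" using k
          by (metis mod_Suc One_nat_def Suc_inject nat.distinct(1) )
        then show ?thesis using 2 ceq by simp
      qed
    qed
    have "0 = (\<Sum>u\<in>set cs. skew_entry ar (c (Suc i)) u * x u)" using x cin by simp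
    also have "\<dots> = (\<Sum>u\<in>{c i, c (i + 2)}. skew_entry ar (c (Suc i)) u * x u)"
      by (rule sum.mono_neutral_right) (use nz cin in \<open>auto simp: skew_entry_eq_0_iff\<close>)
    also have "\<dots> = - s i * y i + s (Suc i) * y (i + 2)"
    proof -
      have "skew_entry ar (c (Suc i)) (c i) = - s i"
        using orient by (auto simp: s_def skew_entry_def oriented_graph_def)
      then show ?thesis using ne by (simp add: s_def y_def)
    qed
    finally have "s (Suc i) * y (i + 2) = s i * y i" by simp
    then have "s (Suc i) * s (Suc i) * y (i + 2) = s i * s (Suc i) * y i"
      by (metis mult.assoc mult.commute)
    then show ?thesis by (simp add: ss)
  qed
  have walk: "y (i + 2 * m) = (\<Prod>j<2 * m. s (i + j)) * y i" for i m
  proof (induction m)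
    case (Suc m)
    have "y (i + 2 * Suc m) = s (i + 2 * m) * s (Suc (i + 2 * m)) * y (i + 2 * m)"
      using step[of "i + 2 * m"] by simp
    then show ?case using Suc by simp
  qed simp
  have per: "c (i + k) = c i" for i by (simp add: ceq)
  \<comment> \<open>The product does not depend on the starting point: moving it by one drops the
    factor \<open>s i\<close> at the front and regains it at the end.\<close>
  have shift: "(\<Prod>j<k. s (i + j)) = (\<Prod>j<k. s j)" for i
  proof (induction i)
    case (Suc i)
    have "s i * (\<Prod>j<k. s (Suc i + j)) = (\<Prod>j<Suc k. s (i + j))"
      by (subst prod.lessThan_Suc_shift) simp
    also have "\<dots> = (\<Prod>j<k. s (i + j)) * s i"
      using per[of i] per[of "Suc i"] by (simp add: s_def)
    finally have "s i * s i * (\<Prod>j<k. s (Suc i + j)) = s i * s i * (\<Prod>j<k. s (i + j))"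
      by (metis mult.assoc mult.commute)
    then show ?case using Suc ss by simp
  qed simp
  have "cycle_sign_prod ar cs = (\<Prod>j<k. s j)"
    unfolding cycle_sign_prod_def k_def[symmetric] by (rule prod.cong) (auto simp: s_def c_def)
  \<comment> \<open>All factors are 1 or -1, so the square of the product is 1 and a nonpositive
    product must be -1.\<close>
  then have "(\<Prod>j<k. s j) \<le> 0" using neg by simp
  moreover have "(\<Prod>j<k. s j) * (\<Prod>j<k. s j) = 1"
    by (simp add: prod.distrib[symmetric] ss)
  ultimately have prod: "(\<Prod>j<k. s j) = -1"
    by (metis square_eq_1_iff not_one_le_zero)
  have "y i = 0" for i
  proof -
    have "2 * (k div 2) = k" using ev by (simp add: k_def)
    then have "y (i + k) = - y i" using walk[of i "k div 2"] shift[of i] prod by simp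
    then show ?thesis using per by (simp add: y_def)
  qed
  moreover have "\<exists>i. w = c i" if "w \<in> set cs" for w
    using that by (metis c_def in_set_conv_nth k_def mod_less)
  ultimately show "\<forall>w\<in>set cs. x w = 0" by (auto simp: y_def)
qed

subsection \<open>Branches of a unicyclic graph\<close>

lemma rtranclp_distinct_path:
  assumes "D\<^sup>*\<^sup>* x y"
  obtains ps where "ps \<noteq> []" "hd ps = x" "last ps = y" "successively D ps" "distinct ps"
proof -
  have "\<exists>ps. ps \<noteq> [] \<and> hd ps = x \<and> last ps = y \<and> successively D ps \<and> distinct ps"
    using assms
  proof (induction rule: rtranclp_induct)
    case base
    have "[x] \<noteq> [] \<and> hd [x] = x \<and> last [x] = x \<and> successively D [x] \<and> distinct [x]" by simp
    then show ?case by blast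
  next
    case (step y z)
    then obtain ps where ps: "ps \<noteq> []" "hd ps = x" "last ps = y" "successively D ps" "distinct ps"
      by blast
    show ?case
    proof (cases "z \<in> set ps")
      case True
      \<comment> \<open>A step back onto the path is absorbed by cutting the path off at that
        vertex.\<close>
      then obtain as bs where "ps = as @ z # bs" by (meson split_list)
      then have "as @ [z] \<noteq> [] \<and> hd (as @ [z]) = x \<and> last (as @ [z]) = z \<and>
          successively D (as @ [z]) \<and> distinct (as @ [z])"
        using ps by (auto simp: hd_append successively_append_iff)
      then show ?thesis by blast
    next
      case False
      then have "ps @ [z] \<noteq> [] \<and> hd (ps @ [z]) = x \<and> last (ps @ [z]) = z \<and>
          successively D (ps @ [z]) \<and> distinct (ps @ [z])"
        using ps step by (auto simp: hd_append successively_append_iff)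
      then show ?thesis by blast
    qed
  qed
  then show thesis using that by blast
qed

text \<open>A simple \<open>D\<close>-path from \<open>x\<close> to \<open>y\<close> has at least
  three vertices because \<open>x\<close> and \<open>y\<close> are distinct and not
  \<open>D\<close>-adjacent; the edge between them closes it. The bound on the edges is what later
  contradicts the uniqueness of the cycle.\<close>

lemma cycle_through_edge:
  assumes "E y x" "x \<noteq> y" and DE: "D \<le> E" and "\<not> D x y" "D\<^sup>*\<^sup>* x y"
  obtains ds where "is_cycle E ds" "cycle_edges ds \<subseteq> insert {x, y} {{a, b} |a b. D a b}"
proof -
  obtain ps where ps: "ps \<noteq> []" "hd ps = x" "last ps = y" "successively D ps" "distinct ps"
    using rtranclp_distinct_path[OF assms(5)] .
  have "length ps \<ge> 3"
  proof (rule ccontr)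
    assume "\<not> length ps \<ge> 3"
    then consider a where "ps = [a]" | a b where "ps = [a, b]"
      using ps(1) by (cases ps; cases "tl ps"; cases "tl (tl ps)") auto
    then show False using ps assms(2,4) by cases auto
  qed
  then have "is_cycle E ps"
    using ps assms(1) predicate2D[OF DE] by (intro is_cycle_closed_path) (auto intro: successively_mono)
  moreover have "cycle_edges ps \<subseteq> insert {x, y} {{a, b} |a b. D a b}"
  proof
    fix e assume "e \<in> cycle_edges ps"
    then obtain i where i: "i < length ps" "e = {ps ! i, ps ! ((i + 1) mod length ps)}"
      unfolding cycle_edges_def by blast
    show "e \<in> insert {x, y} {{a, b} |a b. D a b}"
    proof (cases "Suc i < length ps")
      case True
      then have "D (ps ! i) (ps ! Suc i)" using ps(4) by (simp add: successively_conv_nth)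
      then show ?thesis using i True by auto
    next
      case False
      then have "i = length ps - 1" using i by auto
      then have "e = {y, x}" using i ps by (simp add: last_conv_nth hd_conv_nth)
      then show ?thesis by auto
    qed
  qed
  ultimately show thesis using that by blast
qed

text \<open>Uniqueness is stated for edge sets, which are independent of the starting point and
  direction of the list, so \<open>cs\<close> may be replaced by any of its rotations.\<close>

locale unicyclic_graph =
  fixes E :: "'v::finite \<Rightarrow> 'v \<Rightarrow> bool" and cs :: "'v list"
  assumes sym: "E x y \<Longrightarrow> E y x" and irrefl: "\<not> E x x"
    and conn: "E\<^sup>*\<^sup>* x y"
    and cyc: "is_cycle E cs"
    and uniq: "is_cycle E ds \<Longrightarrow> cycle_edges ds = cycle_edges cs"
begin

abbreviation D where "D \<equiv> del_cycle E cs"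
abbreviation T where "T \<equiv> branch_verts E cs"

lemma length_cs: "length cs \<ge> 3" and distinct_cs: "distinct cs"
  using cyc by (auto simp: is_cycle_def)

lemma cs_ne: "cs \<noteq> []"
  using length_cs by auto

lemma set_cycle: "is_cycle E ds \<Longrightarrow> set ds = set cs"
proof -
  assume ds: "is_cycle E ds"
  then have "ds \<noteq> []" by (auto simp: is_cycle_def)
  then show ?thesis using uniq[OF ds] Union_cycle_edges[of ds] Union_cycle_edges[OF cs_ne] by simp
qed

lemma cycle_edges_rotate: "cycle_edges (rotate m cs) = cycle_edges cs"
  by (rule uniq[OF is_cycle_rotate[OF cyc]])

lemma del_cycle_rotate: "del_cycle E (rotate m cs) = D"
  by (intro ext) (simp add: del_cycle_def cycle_edges_rotate)

lemma branch_verts_rotate: "branch_verts E (rotate m cs) = T"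
  by (intro ext) (simp add: branch_verts_def del_cycle_rotate)

text \<open>Carries statements about \<open>cs ! 0\<close> over to an arbitrary cycle
  vertex.\<close>

lemma unicyclic_graph_rotate: "unicyclic_graph E (rotate m cs)"
  by unfold_locales
    (auto simp: sym irrefl conn cycle_edges_rotate uniq intro: is_cycle_rotate[OF cyc])

lemma cycle_edge_subset: "e \<in> cycle_edges cs \<Longrightarrow> e \<subseteq> set cs"
  using Union_cycle_edges[OF cs_ne] by blast

lemma D_imp_E: "D x y \<Longrightarrow> E x y"
  by (simp add: del_cycle_def)

lemma D_sym: "D x y \<Longrightarrow> D y x"
  by (auto simp: del_cycle_def insert_commute sym)

lemma branch_root: "v \<in> T v"
  by (simp add: branch_verts_def)

lemma branch_step: "x \<in> T v \<Longrightarrow> D x y \<Longrightarrow> y \<in> T v"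
  unfolding branch_verts_def by (auto intro: rtranclp.rtrancl_into_rtrancl)

lemma nth_adj: "Suc i < length cs \<Longrightarrow> E (cs ! i) (cs ! Suc i)"
  using successively_cycle[OF cyc] by (simp add: successively_conv_nth)

text \<open>A walk from the first to another cycle vertex that avoids the cycle edges, continued along the
  cycle to the second vertex, avoids both cycle edges at the first vertex; closing it up gives a cycle
  that misses one of them.\<close>

lemma D_not_connects_cycle_hd:
  assumes b: "0 < b" "b < length cs" and walk: "D\<^sup>*\<^sup>* (cs ! 0) (cs ! b)"
  shows False
proof -
  let ?k = "length cs"
  define e0 where "e0 = {cs ! 0, cs ! 1}"
  define e1 where "e1 = {cs ! (?k - 1), cs ! 0}"
  define F where "F x y \<longleftrightarrow> E x y \<and> {x, y} \<noteq> e0 \<and> {x, y} \<noteq> e1" for x y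
  have k: "?k \<ge> 3" by (rule length_cs)
  have nth_inj: "cs ! i = cs ! j \<longleftrightarrow> i = j" if "i < ?k" "j < ?k" for i j
    using that distinct_cs by (simp add: nth_eq_iff_index_eq)
  have "e0 = {cs ! 0, cs ! ((0 + 1) mod ?k)}" using k by (simp add: e0_def)
  then have e0: "e0 \<in> cycle_edges cs" unfolding cycle_edges_def using k cs_ne by blast
  have "?k - 1 + 1 = ?k" using k by linarith
  then have "(?k - 1 + 1) mod ?k = 0" by (simp only: mod_self)
  then have "e1 = {cs ! (?k - 1), cs ! ((?k - 1 + 1) mod ?k)}" by (simp only: e1_def)
  then have e1: "e1 \<in> cycle_edges cs" unfolding cycle_edges_def using cs_ne
    by (metis (mono_tags, lifting) diff_less length_greater_0_conv mem_Collect_eq zero_less_one)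
  have "cs ! (?k - 1) \<noteq> cs ! 1" "cs ! (?k - 1) \<noteq> cs ! 0"
    using k nth_inj[of "?k - 1" 1] nth_inj[of "?k - 1" 0] by linarith+
  then have ne: "e1 \<noteq> e0" by (auto simp: e0_def e1_def doubleton_eq_iff)
  have DF: "F x y" if "D x y" for x y
    using that e0 e1 by (auto simp: F_def del_cycle_def)
  have "D\<^sup>*\<^sup>* \<le> F\<^sup>*\<^sup>*" by (rule rtranclp_mono) (use DF in blast)
  then have w1: "F\<^sup>*\<^sup>* (cs ! 0) (cs ! b)" using walk by blast
  \<comment> \<open>Descending along the cycle to position 1 never touches \<open>cs ! 0\<close>, so
    neither \<open>e0\<close> nor \<open>e1\<close> is used.\<close>
  have "Suc i < ?k \<Longrightarrow> F\<^sup>*\<^sup>* (cs ! Suc i) (cs ! 1)" for i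
  proof (induction i)
    case (Suc i)
    have "cs ! 0 \<notin> {cs ! Suc (Suc i), cs ! Suc i}"
      using nth_inj[of 0 "Suc (Suc i)"] nth_inj[of 0 "Suc i"] Suc.prems by fastforce
    then have "F (cs ! Suc (Suc i)) (cs ! Suc i)"
      using sym[OF nth_adj[OF Suc.prems]] by (auto simp: F_def e0_def e1_def)
    then show ?case using Suc by (meson Suc_lessD converse_rtranclp_into_rtranclp)
  qed simp
  from this[of "b - 1"] have "F\<^sup>*\<^sup>* (cs ! b) (cs ! 1)" using b by simp
  with w1 have w: "F\<^sup>*\<^sup>* (cs ! 0) (cs ! 1)" by simp
  have E01: "E (cs ! 1) (cs ! 0)" using sym[OF nth_adj[of 0]] k by simp
  have ne01: "cs ! 0 \<noteq> cs ! 1" using E01 irrefl by metis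
  have nF: "\<not> F (cs ! 0) (cs ! 1)" by (simp add: F_def e0_def)
  have "F \<le> E" by (auto simp: F_def)
  \<comment> \<open>The closing edge is \<open>e0\<close> and all other edges satisfy
    \<open>F\<close>, so \<open>e1\<close> is missing from this cycle, although uniqueness demands
    it.\<close>
  from cycle_through_edge[where E = E and D = F, OF E01 ne01 this nF w]
  obtain ds where ds: "is_cycle E ds" "cycle_edges ds \<subseteq> insert {cs ! 0, cs ! 1} {{a, b} |a b. F a b}" .
  then have "e1 \<in> {{a, b} |a b. F a b}" using uniq[OF ds(1)] e1 ne unfolding e0_def by blast
  then show False by (auto simp: F_def)
qed

lemma D_not_connects_cycle:
  assumes "u \<in> set cs" "v \<in> set cs" "D\<^sup>*\<^sup>* u v" shows "u = v"
proof (rule ccontr)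
  assume ne: "u \<noteq> v"
  obtain m where m: "rotate m cs ! 0 = u" using rotate_to_hd[OF assms(1)] .
  interpret R: unicyclic_graph E "rotate m cs" by (rule unicyclic_graph_rotate)
  obtain b where b: "b < length (rotate m cs)" "rotate m cs ! b = v"
    using assms(2) by (metis in_set_conv_nth set_rotate)
  have "0 < b" using b m ne by (metis gr0I)
  then show False using R.D_not_connects_cycle_hd[of b] b m assms(3) by (simp add: del_cycle_rotate)
qed

lemma D_rtranclp_sym: "D\<^sup>*\<^sup>* x y \<Longrightarrow> D\<^sup>*\<^sup>* y x"
proof (induction rule: rtranclp_induct)
  case (step y z)
  then show ?case using D_sym converse_rtranclp_into_rtranclp[of D z y x] by blast
qed simp

lemma branch_disjoint:
  assumes "u \<in> set cs" "v \<in> set cs" "w \<in> T u" "w \<in> T v" shows "u = v"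
proof (rule D_not_connects_cycle[OF assms(1,2)])
  show "D\<^sup>*\<^sup>* u v" using assms(3,4) D_rtranclp_sym unfolding branch_verts_def
    by (metis mem_Collect_eq rtranclp_trans)
qed

text \<open>Along a walk starting on the cycle, an edge off the cycle stays in the current branch,
  and a cycle edge ends at a cycle vertex, the root of its own branch.\<close>

lemma branch_cover:
  obtains v where "v \<in> set cs" "w \<in> T v"
proof -
  have "\<exists>v\<in>set cs. w \<in> T v" using conn[of "cs ! 0" w]
  proof (induction rule: rtranclp_induct)
    case base
    show ?case using branch_root cs_ne by (metis length_greater_0_conv nth_mem)
  next
    case (step w z)
    show ?case
    proof (cases "D w z")
      case True then show ?thesis using step branch_step by blast
    next
      case False
      then have "{w, z} \<in> cycle_edges cs" using step by (simp add: del_cycle_def)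
      then have "z \<in> set cs" using cycle_edge_subset by blast
      then show ?thesis using branch_root by blast
    qed
  qed
  then show thesis using that by blast
qed

lemma branch_Int_cycle: "v \<in> set cs \<Longrightarrow> w \<in> T v \<Longrightarrow> w \<in> set cs \<Longrightarrow> w = v"
  using branch_disjoint branch_root by blast

lemma D_imp_same_branch: "x \<in> T u \<Longrightarrow> y \<in> T v \<Longrightarrow> u \<in> set cs \<Longrightarrow> v \<in> set cs \<Longrightarrow> D x y \<Longrightarrow> u = v"
  using branch_step branch_disjoint by blast

lemma chordless:
  assumes "x \<in> set cs" "y \<in> set cs" "E x y" shows "{x, y} \<in> cycle_edges cs"
proof (rule ccontr)
  assume "\<not> ?thesis"
  then have "D x y" using assms by (simp add: del_cycle_def)
  then have "x = y" using D_imp_same_branch branch_root assms by blast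
  then show False using assms irrefl by blast
qed

lemma E_off_cycle: "E x y \<Longrightarrow> x \<notin> set cs \<or> y \<notin> set cs \<Longrightarrow> D x y"
  using cycle_edge_subset by (auto simp: del_cycle_def)

text \<open>The triangle would be a cycle with an edge outside
  \<open>cycle_edges cs\<close>.\<close>

lemma no_triangle: "D a b \<Longrightarrow> D b c \<Longrightarrow> D c a \<Longrightarrow> False"
proof -
  assume tri: "D a b" "D b c" "D c a"
  then have ne: "a \<noteq> b" "b \<noteq> c" "c \<noteq> a" using irrefl D_imp_E by blast+
  have "is_cycle E [a, b, c]"
    using tri ne D_imp_E by (intro is_cycle_closed_path) auto
  then have "cycle_edges [a, b, c] = cycle_edges cs" by (rule uniq)
  moreover have "{a, b} \<in> cycle_edges [a, b, c]"
    unfolding cycle_edges_def by (rule CollectI, rule exI[of _ 0]) simp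
  ultimately show False using tri(1) by (simp add: del_cycle_def)
qed

lemma branch_nbr:
  assumes "x \<in> T v" "T v \<noteq> {v}" obtains y where "y \<in> T v" "D x y"
proof (cases "x = v")
  case True
  obtain w where "w \<in> T v" "w \<noteq> v" using assms(2) branch_root by blast
  then have "D\<^sup>*\<^sup>* v w" by (simp add: branch_verts_def)
  then obtain y where "D v y" using \<open>w \<noteq> v\<close> by (metis converse_rtranclpE)
  then show thesis using that True branch_step branch_root by blast
next
  case False
  have "D\<^sup>*\<^sup>* v x" using assms(1) by (simp add: branch_verts_def)
  then obtain y where "D\<^sup>*\<^sup>* v y" "D y x" using False by (metis rtranclp.cases)
  then show thesis using that D_sym by (simp add: branch_verts_def)
qed

text \<open>With matching number at most 1 any two edges meet. Pairwise meeting edges share a common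
  vertex or form a triangle, and \<open>no_triangle\<close> excludes the latter.\<close>

lemma is_star_branch:
  assumes small: "\<And>M. is_matching (T v) D M \<Longrightarrow> card M \<le> 1" and ne: "T v \<noteq> {v}"
  shows "is_star (T v) D"
proof -
  have meet: "a = c \<or> a = d \<or> b = c \<or> b = d"
    if ab: "a \<in> T v" "D a b" and cd: "c \<in> T v" "D c d" for a b c d
  proof (rule ccontr)
    assume neg: "\<not> ?thesis"
    have "is_matching (T v) D {{a, b}, {c, d}}"
      unfolding is_matching_def
    proof (intro conjI)
      have "b \<in> T v" "d \<in> T v" using ab cd branch_step by blast+
      then show "{{a, b}, {c, d}} \<subseteq> graph_edges (T v) D"
        unfolding graph_edges_def using ab cd by blast
    qed (use neg in auto)
    from small[OF this] show False using neg by (auto simp: doubleton_eq_iff)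
  qed
  obtain a b where ab: "a \<in> T v" "D a b" using branch_nbr[OF branch_root ne] branch_root by metis
  have "\<exists>c\<in>T v. \<forall>x\<in>T v. \<forall>y. D x y \<longrightarrow> x = c \<or> y = c"
  proof (cases "\<forall>x\<in>T v. \<forall>y. D x y \<longrightarrow> x = a \<or> y = a")
    case True then show ?thesis using ab by blast
  next
    case False
    then obtain x y where xy: "x \<in> T v" "D x y" "x \<noteq> a" "y \<noteq> a" by blast
    have bT: "b \<in> T v" using ab branch_step by blast
    \<comment> \<open>An edge that avoids \<open>a\<close> must meet \<open>ab\<close> in
      \<open>b\<close>. An edge avoiding \<open>b\<close> would then have to be \<open>ad\<close>,
      completing the triangle \<open>a\<close>, \<open>b\<close>, \<open>d\<close>; so
      \<open>b\<close> is the centre.\<close>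
    obtain d where d: "d \<in> T v" "D b d" "d \<noteq> a"
      using meet[OF ab xy(1,2)] xy bT D_sym branch_step by blast
    have "x = b \<or> y = b" if f: "x \<in> T v" "D x y" for x y
    proof (rule ccontr)
      assume neg: "\<not> ?thesis"
      then have "x = a \<and> y = d \<or> x = d \<and> y = a"
        using meet[OF f ab] meet[OF f bT d(2)] d(3) by blast
      then have "D d a" using f D_sym by blast
      then show False using no_triangle ab d by blast
    qed
    then show ?thesis using bT by blast
  qed
  then obtain c where c: "c \<in> T v" "\<And>x y. x \<in> T v \<Longrightarrow> D x y \<Longrightarrow> x = c \<or> y = c" by blast
  have "D c x" if x: "x \<in> T v" "x \<noteq> c" for x
  proof -
    obtain y where "y \<in> T v" "D x y" using branch_nbr[OF x(1) ne] .
    then show ?thesis using c x D_sym by blast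
  qed
  then show ?thesis unfolding is_star_def using c by blast
qed

text \<open>The vertices after \<open>cs ! 0\<close> are paired consecutively, at positions 1 and 2,
  3 and 4, and so on; for even length the last vertex stays unmatched.\<close>

lemma path_matching:
  assumes "set cs - {cs ! 0} \<subseteq> W"
  obtains P where "is_matching W E P" "card P = (length cs - 1) div 2" "\<Union>P \<subseteq> set cs - {cs ! 0}"
proof -
  let ?m = "(length cs - 1) div 2"
  define f where "f i = {cs ! (2 * i + 1), cs ! (2 * i + 2)}" for i
  have nth_inj: "cs ! i = cs ! j \<longleftrightarrow> i = j" if "i < length cs" "j < length cs" for i j
    using that distinct_cs by (simp add: nth_eq_iff_index_eq)
  have bound: "2 * i + 2 < length cs" if "i < ?m" for i using that by linarith
  have fne: "f i \<inter> f j = {}" if ij: "i < ?m" "j < ?m" "i \<noteq> j" for i j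
  proof -
    have "2 * i + 1 \<noteq> 2 * j + 2" "2 * i + 2 \<noteq> 2 * j + 1" by presburger+
    then show ?thesis
      using ij bound[OF ij(1)] bound[OF ij(2)] unfolding f_def by (auto simp: nth_inj)
  qed
  have fsub: "f i \<subseteq> set cs - {cs ! 0}" if "i < ?m" for i
    using bound[OF that] nth_inj[of "2*i+1" 0] nth_inj[of "2*i+2" 0] cs_ne by (auto simp: f_def)
  have "is_matching W E (f ` {..<?m})"
    unfolding is_matching_def
  proof (intro conjI ballI impI subsetI)
    fix e assume "e \<in> f ` {..<?m}"
    then obtain i where i: "i < ?m" "e = f i" by blast
    have "E (cs ! (2 * i + 1)) (cs ! (2 * i + 2))" using nth_adj[of "2 * i + 1"] bound[OF i(1)] by simp
    then show "e \<in> graph_edges W E"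
      using fsub[OF i(1)] assms i(2) unfolding graph_edges_def f_def by blast
  next
    fix e e' assume "e \<in> f ` {..<?m}" "e' \<in> f ` {..<?m}" "e \<noteq> e'"
    then show "e \<inter> e' = {}" using fne by auto
  qed
  moreover have "card (f ` {..<?m}) = ?m"
  proof -
    have "inj_on f {..<?m}"
    proof (rule inj_onI, rule ccontr)
      fix i j assume "i \<in> {..<?m}" "j \<in> {..<?m}" "f i = f j" "i \<noteq> j"
      then have "f i = {}" using fne[of i j] by auto
      then show False by (simp add: f_def)
    qed
    then show ?thesis by (simp add: card_image)
  qed
  ultimately show thesis using that[of "f ` {..<?m}"] fsub by blast
qed

section \<open>Recognising U*\<close>

text \<open>The root \<open>cs ! 0\<close> is not the centre \<open>c\<close>, hence a leaf of the
  star in its branch. Cycle vertices are numbered by position and \<open>c\<close> by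
  \<open>k\<close>; the other leaves are interchangeable, so any numbering of them works.\<close>

lemma iso_ustar_single_star_branch:
  assumes triv: "\<And>u. u \<in> set cs \<Longrightarrow> u \<noteq> cs ! 0 \<Longrightarrow> T u = {u}"
    and c: "c \<in> T (cs ! 0)" "c \<noteq> cs ! 0"
    and star: "\<And>x. x \<in> T (cs ! 0) \<Longrightarrow> x \<noteq> c \<Longrightarrow> D c x"
      "\<And>x y. x \<in> T (cs ! 0) \<Longrightarrow> y \<in> T (cs ! 0) \<Longrightarrow> D x y \<Longrightarrow> x = c \<or> y = c"
  shows "iso_ustar E (length cs) CARD('v)"
proof -
  define k where "k = length cs"
  define n where "n = CARD('v)"
  define R where "R = - insert c (set cs)"
  have k: "k \<ge> 3" using length_cs by (simp add: k_def)
  have v: "cs ! 0 \<in> set cs" using cs_ne by simp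
  have cC: "c \<notin> set cs" using c v branch_Int_cycle by blast
  have off: "w \<in> T (cs ! 0)" if w: "w \<notin> set cs" for w
  proof -
    obtain u where "u \<in> set cs" "w \<in> T u" using branch_cover .
    then show ?thesis using triv w by (cases "u = cs ! 0") auto
  qed
  have cardC: "card (insert c (set cs)) = Suc k"
    using cC distinct_cs by (simp add: distinct_card k_def)
  then have "card R = n - Suc k" by (simp add: R_def Compl_eq_Diff_UNIV card_Diff_subset n_def)
  moreover have "Suc k \<le> n" using cardC card_mono[of UNIV "insert c (set cs)"] by (simp add: n_def)
  ultimately obtain g where g: "bij_betw g R {Suc k..<n}"
    using finite_same_card_bij[of R "{Suc k..<n}"] by auto
  obtain h where h: "bij_betw h (set cs) {..<k}" "\<And>i. i < k \<Longrightarrow> h (cs ! i) = i"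
  proof
    have b: "bij_betw (\<lambda>i. cs ! i) {..<k} (set cs)"
      using distinct_cs by (auto intro!: bij_betw_nth simp: k_def)
    show "bij_betw (inv_into {..<k} ((!) cs)) (set cs) {..<k}" by (rule bij_betw_inv_into[OF b])
    show "inv_into {..<k} ((!) cs) (cs ! i) = i" if "i < k" for i
      using that by (intro inv_into_f_f) (use b in \<open>auto simp: bij_betw_def\<close>)
  qed
  define f where "f x = (if x \<in> set cs then h x else if x = c then k else g x)" for x
  have "bij_betw f (set cs) {..<k}"
    using h(1) by (rule bij_betw_cong[THEN iffD1, rotated]) (simp add: f_def)
  moreover have "bij_betw f {c} {k}" using cC by (simp add: f_def bij_betw_def)
  moreover have "bij_betw f R {Suc k..<n}"
    using g by (rule bij_betw_cong[THEN iffD1, rotated]) (auto simp: f_def R_def)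
  ultimately have "bij_betw f (set cs \<union> ({c} \<union> R)) ({..<k} \<union> ({k} \<union> {Suc k..<n}))"
    by (intro bij_betw_combine) auto
  moreover have "set cs \<union> ({c} \<union> R) = UNIV" by (auto simp: R_def)
  moreover have "{..<k} \<union> ({k} \<union> {Suc k..<n}) = {0..<n}" using \<open>Suc k \<le> n\<close> by auto
  ultimately have bij: "bij_betw f UNIV {0..<n}" by simp
  have fC: "f (cs ! i) = i" if "i < k" for i using that h(2) by (simp add: f_def k_def)
  have fc: "f c = k" using cC by (simp add: f_def)
  have fR: "k < f x" "f x < n" if "x \<in> R" for x
    using bij_betwE[OF \<open>bij_betw f R {Suc k..<n}\<close>] that by (auto simp: Suc_le_eq)
  have adjCC: "E (cs ! i) (cs ! j) \<longleftrightarrow> j = (i + 1) mod k \<or> i = (j + 1) mod k" if ij: "i < k" "j < k" for i j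
  proof
    assume "E (cs ! i) (cs ! j)"
    then have "{cs ! i, cs ! j} \<in> cycle_edges cs" using chordless ij by (simp add: k_def)
    then obtain l where l: "l < k" "{cs ! i, cs ! j} = {cs ! l, cs ! ((l + 1) mod k)}"
      unfolding cycle_edges_def k_def by blast
    have "(l + 1) mod k < k" using k by simp
    then show "j = (i + 1) mod k \<or> i = (j + 1) mod k"
      using l ij distinct_cs unfolding k_def
      by (auto simp: doubleton_eq_iff nth_eq_iff_index_eq)
  next
    have "E (cs ! i) (cs ! ((i + 1) mod k))" if "i < k" for i
      using cyc that unfolding is_cycle_def k_def by blast
    then show "E (cs ! i) (cs ! j)" if "j = (i + 1) mod k \<or> i = (j + 1) mod k"
      using that ij sym by blast
  qed
  \<comment> \<open>The only edge that leaves the cycle joins \<open>cs ! 0\<close> to the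
    centre.\<close>
  have Cw: "w = c \<and> x = cs ! 0" if x: "x \<in> set cs" and w: "w \<notin> set cs" and "E x w" for x w
  proof -
    have "D x w" using that E_off_cycle by blast
    moreover from this have "x = cs ! 0"
      using D_imp_same_branch[OF branch_root off[OF w] x v] by simp
    ultimately show ?thesis using star(2)[OF branch_root off[OF w]] c(2) by simp
  qed
  have Ec0: "E c (cs ! 0)" using star(1)[OF branch_root] c(2) D_imp_E by blast
  have EcR: "E c x" if "x \<in> R" for x
    using that star(1)[OF off, of x] D_imp_E by (auto simp: R_def)
  have ERR: "\<not> E x y" if "x \<in> R" "y \<in> R" for x y
    using that star(2)[OF off off, of x y] E_off_cycle[of x y] by (auto simp: R_def)
  have main: "E x y \<longleftrightarrow> ustar_adj k n (f x) (f y)" for x y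
  proof -
    have cases3: "(\<exists>i<k. z = cs ! i) \<or> z = c \<or> z \<in> R" for z
      by (auto simp: R_def in_set_conv_nth k_def)
    have adjCR: "\<not> E x y" "\<not> E y x" if "i < k" "x = cs ! i" "y \<in> R" for i x y
      using that Cw[of x y] sym by (auto simp: R_def k_def)
    have adjCc: "E (cs ! i) c \<longleftrightarrow> i = 0" "E c (cs ! i) \<longleftrightarrow> i = 0" if "i < k" for i
    proof -
      have "i = 0" if "E (cs ! i) c"
        using Cw[of "cs ! i" c] cC that \<open>i < k\<close> distinct_cs cs_ne
        by (simp add: k_def nth_eq_iff_index_eq)
      then show "E (cs ! i) c \<longleftrightarrow> i = 0" "E c (cs ! i) \<longleftrightarrow> i = 0" using Ec0 sym by blast+
    qed
    have kn: "k < n" using \<open>Suc k \<le> n\<close> by simp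
    consider (CC) i j where "i < k" "x = cs ! i" "j < k" "y = cs ! j"
      | (Cc) i where "i < k" "x = cs ! i" "y = c" | (cC') i where "i < k" "y = cs ! i" "x = c"
      | (CR) i where "i < k" "x = cs ! i" "y \<in> R" | (RC) i where "i < k" "y = cs ! i" "x \<in> R"
      | (cc) "x = c" "y = c" | (cR) "x = c" "y \<in> R" | (Rc) "y = c" "x \<in> R" | (RR) "x \<in> R" "y \<in> R"
      using cases3[of x] cases3[of y] by metis
    then show ?thesis
    proof cases
      case CC
      then show ?thesis using adjCC[of i j] kn
        by (auto simp: ustar_adj_def fC doubleton_eq_iff)
    next
      case Cc
      then show ?thesis using adjCc[of i] kn k
        by (auto simp: ustar_adj_def fC fc doubleton_eq_iff)
    next
      case cC'
      then show ?thesis using adjCc[of i] kn k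
        by (auto simp: ustar_adj_def fC fc doubleton_eq_iff)
    next
      case CR
      then show ?thesis using adjCR[of i x y] fR[of y]
        by (auto simp: ustar_adj_def fC doubleton_eq_iff)
    next
      case RC
      then show ?thesis using adjCR[of i y x] fR[of x]
        by (auto simp: ustar_adj_def fC doubleton_eq_iff)
    next
      case cc
      then show ?thesis using irrefl[of c] k by (auto simp: ustar_adj_def fc doubleton_eq_iff)
    next
      case cR
      then show ?thesis using EcR[of y] fR[of y] kn by (auto simp: ustar_adj_def fc)
    next
      case Rc
      then show ?thesis using sym[OF EcR[of x]] fR[of x] kn by (auto simp: ustar_adj_def fc)
    next
      case RR
      then show ?thesis using ERR[of x y] fR[of x] fR[of y] by (auto simp: ustar_adj_def doubleton_eq_iff)
    qed
  qed
  show ?thesis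
    unfolding iso_ustar_def k_def[symmetric] n_def[symmetric] using bij main by blast
qed

end

subsection \<open>Unicyclic graphs of minimal skew-rank\<close>

theorem theorem4p6:
  fixes ar :: "'v::finite \<Rightarrow> 'v \<Rightarrow> bool"
    and cs :: "'v list" and k n :: nat
  assumes orient: "oriented_graph ar"
    and unicyc: "unicyclic (und ar)"
    and cyc: "is_cycle (und ar) cs"
    and k_def: "k = length cs"
    and n_def: "n = CARD('v)"
    and not_cycle: "k < n"
    and sr: "skew_rank ar = (if even k then k else k + 1)"
  shows
    "(\<forall>v \<in> set cs. saturated (branch_verts (und ar) cs v) (del_cycle (und ar) cs) v \<longrightarrow>
        is_star (branch_verts (und ar) cs v) (del_cycle (und ar) cs) \<and>
        2 * matching_number (UNIV - branch_verts (und ar) cs v) (und ar)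
          = (if even k then k - 2 else k - 1))
     \<and>
     ((\<forall>v \<in> set cs. \<not> saturated (branch_verts (und ar) cs v) (del_cycle (und ar) cs) v) \<longrightarrow>
        (odd k \<longrightarrow> iso_ustar (und ar) k n) \<and>
        (even k \<longrightarrow> iso_ustar (und ar) k n \<and> evenly_oriented ar cs))"
proof -
  let ?E = "und ar"
  have irr: "\<not> ?E x x" for x using orient by (auto simp: oriented_graph_def und_def)
  interpret U: unicyclic_graph ?E cs
    using unicyc cyc irr und_sym[of ar] unfolding unicyclic_def connected_graph_def
    by unfold_locales blast+
  have k3: "k \<ge> 3" using U.length_cs by (simp add: k_def)
  have sr': "skew_rank ar = 2 * ((k - 1) div 2) + 2"
    using sr k3 by (cases "even k") (auto elim!: evenE oddE)
  have rank_matching: "2 * card M \<le> skew_rank ar"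
    if "v \<in> set cs" "is_matching UNIV ?E M" "\<And>e. e \<in> M \<Longrightarrow> v \<in> e \<Longrightarrow> \<not> e \<subseteq> set cs" for v M
    using card_le_skew_rank[OF nonsingular_on_matching[OF irr U.set_cycle that]]
      card_Union_matching[OF that(2) irr] by simp

  have part1: "is_star (U.T v) U.D \<and> 2 * matching_number (UNIV - U.T v) ?E = (if even k then k - 2 else k - 1)"
    if v: "v \<in> set cs" and sat: "saturated (U.T v) U.D v" for v
  proof -
    obtain m where m: "rotate m cs ! 0 = v" using rotate_to_hd[OF v] .
    interpret R: unicyclic_graph ?E "rotate m cs" by (rule U.unicyclic_graph_rotate)
    obtain M1 where M1: "is_matching (U.T v) U.D M1" "card M1 = matching_number (U.T v) U.D"
      and vM1: "v \<in> \<Union>M1"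
      using max_matching_exists sat unfolding saturated_def is_max_matching_def by metis
    obtain M2 where M2: "is_matching (UNIV - U.T v) ?E M2"
        "card M2 = matching_number (UNIV - U.T v) ?E"
      using max_matching_exists unfolding is_max_matching_def by metis
    \<comment> \<open>The branch meets the cycle only in \<open>v\<close>, so the path matching of
      the cycle without \<open>v\<close> lies outside the branch and bounds \<open>card M2\<close>
      from below.\<close>
    have "set (rotate m cs) - {rotate m cs ! 0} \<subseteq> UNIV - U.T v"
      using U.branch_Int_cycle[OF v] m by auto
    from R.path_matching[OF this] have ge: "(k - 1) div 2 \<le> card M2"
      using card_le_matching_number M2(2) by (metis k_def length_rotate)
    have disj: "\<Union>M1 \<inter> \<Union>M2 = {}"
      using Union_matching_subset[OF M1(1)] Union_matching_subset[OF M2(1)] by blast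
    have m1: "is_matching UNIV ?E M1" using is_matching_mono[OF M1(1)] U.D_imp_E by blast
    have m2: "is_matching UNIV ?E M2" using is_matching_mono[OF M2(1)] by blast
    have "2 * card (M1 \<union> M2) \<le> skew_rank ar"
    proof (rule rank_matching[OF v is_matching_Un[OF m1 m2 disj]])
      \<comment> \<open>Saturation makes \<open>M1\<close> cover \<open>v\<close>, so the partner of
        \<open>v\<close> lies in its branch and thus off the cycle.\<close>
      fix e assume e: "e \<in> M1 \<union> M2" "v \<in> e"
      then have "e \<in> M1" using disj vM1 by blast
      then obtain x y where xy: "e = {x, y}" "x \<in> U.T v" "y \<in> U.T v" "U.D x y"
        using is_matchingD[OF M1(1)] by metis
      then have "x \<noteq> y" using irr U.D_imp_E by blast
      then show "\<not> e \<subseteq> set cs" using xy U.branch_Int_cycle[OF v] by blast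
    qed
    then have le: "2 * card M1 + 2 * card M2 \<le> 2 * ((k - 1) div 2) + 2"
      using card_matching_Un[OF m1 disj] sr' by simp
    \<comment> \<open>The rank bound leaves no slack: \<open>M1\<close> has at least one edge and
      \<open>M2\<close> at least \<open>(k - 1) div 2\<close>, so both bounds are attained.\<close>
    have "card M1 \<noteq> 0" using vM1 by auto
    then have "card M1 = 1" and "card M2 = (k - 1) div 2" using le ge by linarith+
    moreover have "is_star (U.T v) U.D"
    proof (rule U.is_star_branch)
      show "card M \<le> 1" if "is_matching (U.T v) U.D M" for M
        using card_le_matching_number[OF that] M1(2) \<open>card M1 = 1\<close> by simp
      obtain e where "e \<in> M1" using vM1 by blast
      then obtain x y where "x \<in> U.T v" "y \<in> U.T v" "U.D x y"
        using is_matchingD[OF M1(1)] by metis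
      then show "U.T v \<noteq> {v}" using irr U.D_imp_E by (metis singletonD)
    qed
    ultimately show ?thesis using M2(2) k3 by (auto elim!: evenE oddE)
  qed

  have part2: "iso_ustar ?E k n \<and> (even k \<longrightarrow> evenly_oriented ar cs)"
    if unsat: "\<forall>v\<in>set cs. \<not> saturated (U.T v) U.D v"
  proof -
    have "\<forall>u\<in>set cs. \<exists>M. is_max_matching (U.T u) U.D M \<and> u \<notin> \<Union>M"
      using unsat unfolding saturated_def by blast
    then obtain f where f: "\<And>u. u \<in> set cs \<Longrightarrow> is_max_matching (U.T u) U.D (f u) \<and> u \<notin> \<Union>(f u)"
      by metis
    then have fm: "is_matching (U.T u) U.D (f u)" and fmax: "card (f u) = matching_number (U.T u) U.D"
      and fu: "u \<notin> \<Union>(f u)" if "u \<in> set cs" for u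
      using that unfolding is_max_matching_def by blast+
    \<comment> \<open>Each \<open>f u\<close> misses its root, the only cycle vertex of its branch;
      hence \<open>N\<close> avoids the cycle and can be joined with any matching inside it.\<close>
    define N where "N = \<Union>(f ` set cs)"
    have same: "u = u'"
      if e: "u \<in> set cs" "u' \<in> set cs" "e \<in> f u" "e' \<in> f u'" "e \<inter> e' \<noteq> {}" for u u' e e'
    proof -
      have "e \<subseteq> U.T u" "e' \<subseteq> U.T u'" using e fm Union_matching_subset by blast+
      then show ?thesis using e U.branch_disjoint by blast
    qed
    have Nm: "is_matching UNIV ?E N"
      unfolding is_matching_def
    proof (intro conjI ballI impI subsetI)
      fix e assume "e \<in> N"
      then obtain u where "u \<in> set cs" "e \<in> f u" unfolding N_def by blast
      then obtain x y where "e = {x, y}" "U.D x y" using is_matchingD[OF fm] by metis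
      then show "e \<in> graph_edges UNIV ?E" using U.D_imp_E unfolding graph_edges_def by blast
    next
      fix e e' assume ee: "e \<in> N" "e' \<in> N" "e \<noteq> e'"
      then obtain u u' where u: "u \<in> set cs" "e \<in> f u" "u' \<in> set cs" "e' \<in> f u'"
        unfolding N_def by blast
      show "e \<inter> e' = {}"
      proof (rule ccontr)
        assume ne: "e \<inter> e' \<noteq> {}"
        then have "u = u'" using same u by blast
        then show False using fm[OF u(1)] u ee(3) ne unfolding is_matching_def by blast
      qed
    qed
    have NC: "\<Union>N \<inter> set cs = {}"
    proof -
      have "w \<notin> set cs" if "u \<in> set cs" "w \<in> \<Union>(f u)" for u w
        using that fu Union_matching_subset[OF fm] U.branch_Int_cycle by blast
      then show ?thesis unfolding N_def by blast
    qed
    obtain P where P: "is_matching UNIV ?E P" "card P = (k - 1) div 2" "\<Union>P \<subseteq> set cs - {cs ! 0}"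
      unfolding k_def by (rule U.path_matching[OF subset_UNIV])
    have disj: "\<Union>N \<inter> \<Union>P = {}" using NC P(3) by blast
    have "2 * card (N \<union> P) \<le> skew_rank ar"
    \<comment> \<open>Neither \<open>N\<close> nor \<open>P\<close> covers \<open>cs ! 0\<close>, so
      the condition on its edges holds vacuously.\<close>
    proof (rule rank_matching[OF _ is_matching_Un[OF Nm P(1) disj]])
      show c0: "cs ! 0 \<in> set cs" using U.cs_ne by simp
      show "\<not> e \<subseteq> set cs" if "e \<in> N \<union> P" "cs ! 0 \<in> e" for e
        using that c0 NC P(3) by blast
    qed
    then have N1: "card N \<le> 1" using card_matching_Un[OF Nm disj] P(2) sr' by simp
    have ne: "f u \<noteq> {}" if u: "u \<in> set cs" "U.T u \<noteq> {u}" for u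
    proof -
      obtain y where "y \<in> U.T u" "U.D u y" using U.branch_nbr[OF U.branch_root u(2)] .
      then have "is_matching (U.T u) U.D {{u, y}}"
        using U.branch_root unfolding is_matching_def graph_edges_def by blast
      from card_le_matching_number[OF this] show ?thesis using fmax[OF u(1)] by auto
    qed
    obtain w where w: "w \<notin> set cs"
    proof -
      have "card (set cs) < card (UNIV :: 'v set)"
        using not_cycle n_def k_def by (metis card_length le_less_trans)
      then have "set cs \<noteq> UNIV" by auto
      then show thesis using that by blast
    qed
    obtain v where v: "v \<in> set cs" "w \<in> U.T v" using U.branch_cover .
    have Tv: "U.T v \<noteq> {v}" using v w by auto
    obtain e where e: "e \<in> f v" using ne[OF v(1) Tv] by blast
    \<comment> \<open>A second nontrivial branch would contribute a second edge to \<open>N\<close>,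
      disjoint from \<open>e\<close>.\<close>
    have triv: "U.T u = {u}" if u: "u \<in> set cs" "u \<noteq> v" for u
    proof (rule ccontr)
      assume "U.T u \<noteq> {u}"
      then obtain e' where e': "e' \<in> f u" using ne[OF u(1)] by blast
      have "e \<in> N" "e' \<in> N" using e e' u v unfolding N_def by blast+
      then have "e = e'" using N1 card_le_Suc0_iff_eq[of N] by auto
      moreover have "e \<noteq> {}" using is_matchingD[OF fm[OF v(1)] e] by blast
      ultimately show False using same[OF u(1) v(1) e' e] u(2) by blast
    qed
    have "is_star (U.T v) U.D"
    proof (rule U.is_star_branch[OF _ Tv])
      fix M assume "is_matching (U.T v) U.D M"
      then have "card M \<le> card (f v)" using card_le_matching_number fmax[OF v(1)] by metis
      also have "\<dots> \<le> card N" using v(1) by (intro card_mono) (auto simp: N_def)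
      finally show "card M \<le> 1" using N1 by simp
    qed
    then obtain c where c: "c \<in> U.T v" and star: "\<And>x. x \<in> U.T v \<Longrightarrow> x \<noteq> c \<Longrightarrow> U.D c x"
        "\<And>x y. x \<in> U.T v \<Longrightarrow> y \<in> U.T v \<Longrightarrow> U.D x y \<Longrightarrow> x = c \<or> y = c"
      unfolding is_star_def by blast
    obtain x y where xy: "e = {x, y}" "x \<in> U.T v" "y \<in> U.T v" "U.D x y"
      using is_matchingD[OF fm[OF v(1)] e] by metis
    \<comment> \<open>The edge \<open>e\<close> contains the centre but not the root
      \<open>v\<close>. So the centre is off the cycle, and the other end \<open>l\<close> of
      \<open>e\<close> is a leaf off the cycle.\<close>
    have "c \<in> e" using star(2)[OF xy(2-4)] xy(1) by blast
    then obtain l where l: "e = {l, c}" "U.D l c" "l \<in> U.T v" using xy U.D_sym by blast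
    have "v \<notin> e" using fu[OF v(1)] e by blast
    then have lv: "l \<noteq> v" and cv: "c \<noteq> v" using l by auto
    obtain m where m: "rotate m cs ! 0 = v" using rotate_to_hd[OF v(1)] .
    interpret R: unicyclic_graph ?E "rotate m cs" by (rule U.unicyclic_graph_rotate)
    have "iso_ustar ?E (length (rotate m cs)) CARD('v)"
      using triv c cv star
      by (intro R.iso_ustar_single_star_branch[of c])
        (simp_all add: m U.branch_verts_rotate U.del_cycle_rotate)
    then have iso: "iso_ustar ?E k n" by (simp add: k_def n_def)
    have "evenly_oriented ar cs" if ev: "even k"
    proof (rule ccontr)
      assume "\<not> evenly_oriented ar cs"
      then have "nonsingular_on ar (set cs)"
        using ev U.chordless unfolding evenly_oriented_def k_def
        by (intro nonsingular_on_oddly_oriented_cycle[OF orient cyc]) auto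
      moreover have lC: "l \<notin> set cs" "c \<notin> set cs"
        using l(3) c lv cv U.branch_Int_cycle[OF v(1)] by blast+
      \<comment> \<open>An edge from \<open>l\<close> to the cycle would have to end in
        \<open>v\<close>; the star structure then makes \<open>l\<close> or \<open>v\<close> the
        centre, and neither is. So \<open>l\<close> is pendant at \<open>c\<close> once both are
        added to the cycle.\<close>
      moreover have "\<not> ?E l u" if u: "u \<in> set cs" for u
      proof
        assume "?E l u"
        then have "U.D l u" using U.E_off_cycle lC by blast
        moreover from this have "v = u"
          using U.D_imp_same_branch[OF l(3) U.branch_root v(1) u] by blast
        ultimately have "l = c" using star(2)[OF l(3) U.branch_root] cv by blast
        then show False using l(2) irr U.D_imp_E by blast
      qed
      ultimately have "nonsingular_on ar (insert l (insert c (set cs)))"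
        using nonsingular_on_pendant[OF _ irr] U.D_imp_E[OF l(2)] by blast
      moreover have "l \<noteq> c" using l(2) irr U.D_imp_E by blast
      ultimately have "k + 2 \<le> skew_rank ar"
        using card_le_skew_rank[of ar "insert l (insert c (set cs))"] lC
        by (simp add: k_def distinct_card[OF U.distinct_cs])
      then show False using sr ev by simp
    qed
    then show ?thesis using iso by blast
  qed
  show ?thesis using part1 part2 by blast
qed

end
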